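(* Let $s,t\ge 1$ be integers. Every graph $G$ with no $K^*_{s,t}$ subgraph is $(s,d)$-choosable, where $d:=\lfloor N_1(s,t,\operatorname{mad}(G),2\nabla_{1/2}(G))\rfloor -s+1$ and \[ N_1(s,t,\delta,\delta_1):= \begin{cases} (\delta-s)\left(\binom{\lfloor \delta_1\rfloor}{s-1}(t-1)+\tfrac12 \delta_1\right)+\delta &\text{if } s>2,\\ \tfrac12 (\delta -2)\delta_1t+\delta &\text{if } s=2,\\ t-1&\text{if } s=1. \end{cases} \]
   Context: For integers $s,t\ge 1$, $K^*_{s,t}$ is the bipartite graph obtained from $K_{s,t}$ by adding $\binom{s}{2}$ new vertices, each adjacent to a distinct pair of vertices in the part of size $s$. $\operatorname{mad}(G)$ is the maximum, over all subgraphs $H$ of $G$, of $2|E(H)|/|V(H)|$. $\nabla_{1/2}(G)$ is the maximum of $|E(H)|/|V(H)|$ over all graphs $H$ such that some graph obtained from $H$ by subdividing each edge at most once is a subgraph of $G$. A $k$-list assignment of $G$ assigns a set $L(v)$ of exactly $k$ colours to each vertex $v$; an $L$-colouring picks a colour from $L(v)$ for each $v$; it has defect $d$ if each vertex has at most $d$ neighbours with its own colour. $G$ is $(k,d)$-choosable if for every $k$-list assignment $L$ there is an $L$-colouring of $G$ with defect $d$.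
   Formalization: When ⌊N_1⌋ − s + 1 is negative (e.g. for edgeless graphs with s ≥ 2, where no colouring of a nonempty graph can have negative defect), d is taken to be 0, that is, d := max(0, ⌊N_1⌋ − s + 1). *)

theory Defs
  imports Complex_Main
begin

type_synonym 'a ugraph = "'a set \<times> 'a set set"

abbreviation verts :: "'a ugraph \<Rightarrow> 'a set" where "verts \<equiv> fst"
abbreviation edges :: "'a ugraph \<Rightarrow> 'a set set" where "edges \<equiv> snd"

definition simple_graph :: "'a ugraph \<Rightarrow> bool" where
  "simple_graph G \<longleftrightarrow> finite (verts G) \<and> (\<forall>e\<in>edges G. e \<subseteq> verts G \<and> card e = 2)"

definition subgraph :: "'a ugraph \<Rightarrow> 'a ugraph \<Rightarrow> bool" where
  "subgraph H G \<longleftrightarrow> simple_graph H \<and> verts H \<subseteq> verts G \<and> edges H \<subseteq> edges G"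

(* Some subgraph of G, not necessarily induced, is isomorphic to H. *)
definition contains_copy :: "'a ugraph \<Rightarrow> 'b ugraph \<Rightarrow> bool" where
  "contains_copy G H \<longleftrightarrow>
     (\<exists>f. inj_on f (verts H) \<and> f ` verts H \<subseteq> verts G \<and> (\<forall>e\<in>edges H. f ` e \<in> edges G))"

(* PartS and PartT are the two sides of K_{s,t}; PairV p is the vertex added for the pair p of
   indices of PartS vertices. *)
datatype kstar_vertex = PartS nat | PartT nat | PairV "nat set"

definition K_star :: "nat \<Rightarrow> nat \<Rightarrow> kstar_vertex ugraph" where
  "K_star s t =
     (PartS ` {..<s} \<union> PartT ` {..<t} \<union> PairV ` {p. p \<subseteq> {..<s} \<and> card p = 2},
      {{PartS i, PartT j} | i j. i < s \<and> j < t} \<union>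
      {{PartS i, PairV p} | i p. p \<subseteq> {..<s} \<and> card p = 2 \<and> i \<in> p})"

(* Densities are taken over nonempty graphs only. For a graph without vertices the maximum in mad
   and in nabla_half is over the empty set and has no specified value. *)
definition mad :: "'a ugraph \<Rightarrow> real" where
  "mad G = Max {2 * real (card (edges H)) / real (card (verts H)) | H.
                 subgraph H G \<and> verts H \<noteq> {}}"

(* F is the set of subdivided edges, and m e is the new vertex placed on the edge e. *)
definition le1_subdivision :: "'a ugraph \<Rightarrow> 'a ugraph \<Rightarrow> bool" where
  "le1_subdivision H H' \<longleftrightarrow>
     (\<exists>F m. F \<subseteq> edges H \<and> inj_on m F \<and> m ` F \<inter> verts H = {} \<and>
        H' = (verts H \<union> m ` F, (edges H - F) \<union> {{x, m e} | x e. e \<in> F \<and> x \<in> e}))"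

(* H may be taken on the vertex type of G: if a copy of a subdivision of H lies in G, then H is
   isomorphic to the graph whose vertices are the images in G of the vertices of H. *)
definition nabla_half :: "'a ugraph \<Rightarrow> real" where
  "nabla_half G = Max {real (card (edges H)) / real (card (verts H)) | H.
                 simple_graph H \<and> verts H \<noteq> {} \<and> (\<exists>H'. le1_subdivision H H' \<and> subgraph H' G)}"

(* Colours are natural numbers, which loses nothing since a finite graph with finite lists
   involves only finitely many colours. *)
definition list_assignment :: "'a ugraph \<Rightarrow> nat \<Rightarrow> ('a \<Rightarrow> nat set) \<Rightarrow> bool" where
  "list_assignment G k L \<longleftrightarrow> (\<forall>v\<in>verts G. finite (L v) \<and> card (L v) = k)"

definition list_colouring :: "'a ugraph \<Rightarrow> ('a \<Rightarrow> nat set) \<Rightarrow> ('a \<Rightarrow> nat) \<Rightarrow> bool" where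
  "list_colouring G L c \<longleftrightarrow> (\<forall>v\<in>verts G. c v \<in> L v)"

definition has_defect :: "'a ugraph \<Rightarrow> ('a \<Rightarrow> nat) \<Rightarrow> nat \<Rightarrow> bool" where
  "has_defect G c d \<longleftrightarrow> (\<forall>v\<in>verts G. card {u \<in> verts G. {u, v} \<in> edges G \<and> c u = c v} \<le> d)"

definition choosable :: "'a ugraph \<Rightarrow> nat \<Rightarrow> nat \<Rightarrow> bool" where
  "choosable G k d \<longleftrightarrow>
     (\<forall>L. list_assignment G k L \<longrightarrow> (\<exists>c. list_colouring G L c \<and> has_defect G c d))"

(* Meant for s, t \<ge> 1 and \<delta>1 \<ge> 0, so that nat does not truncate. *)
definition N1 :: "nat \<Rightarrow> nat \<Rightarrow> real \<Rightarrow> real \<Rightarrow> real" where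
  "N1 s t \<delta> \<delta>1 =
     (if s > 2 then
        (\<delta> - real s) * (real (nat \<lfloor>\<delta>1\<rfloor> choose (s - 1)) * (real t - 1) + 1/2 * \<delta>1) + \<delta>
      else if s = 2 then 1/2 * (\<delta> - 2) * \<delta>1 * real t + \<delta>
      else real t - 1)"

(* The integer \<lfloor>N1\<rfloor> - s + 1 is negative for some very sparse graphs (for instance edgeless graphs
   with s \<ge> 2), where no colouring of a nonempty graph has that defect; nat replaces it by 0. *)
definition defect_bound :: "nat \<Rightarrow> nat \<Rightarrow> 'a ugraph \<Rightarrow> nat" where
  "defect_bound s t G = nat (\<lfloor>N1 s t (mad G) (2 * nabla_half G)\<rfloor> - int s + 1)"

end

theory Submission
  imports Defs
begin

text \<open>
  It suffices that every nonempty subgraph \<open>H\<close> of minimum degree at least \<open>s\<close> has an edge whose two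
  ends have degree at most \<open>l = N1\<close>: a colouring of \<open>H\<close> minus such an edge is repaired by recolouring
  one end, because an end with too many neighbours of its own colour has few neighbours left to block
  the other colours of its list. If there is no such edge, the set \<open>A\<close> of vertices of degree at most
  \<open>l\<close> is independent. Assign to as many pairs of vertices in the complement \<open>B\<close> as possible distinct
  common neighbours in \<open>A\<close>. The assigned pairs form a graph on \<open>B\<close> whose 1-subdivision lies in \<open>G\<close>,
  so it is sparse and has few \<open>s\<close>-cliques; by maximality each remaining vertex of \<open>A\<close> is adjacent to
  all of some \<open>s\<close>-clique, and \<open>t\<close> of them on the same clique would give \<open>K_star s t\<close>. Hence \<open>A\<close> is
  small compared with \<open>B\<close>, and the large degrees in \<open>B\<close> contradict the bound \<open>mad G\<close>.
\<close>

section \<open>Degrees and the two density parameters\<close>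

definition nbrs :: "'a ugraph \<Rightarrow> 'a \<Rightarrow> 'a set" where
  "nbrs G v = {u \<in> verts G. {u, v} \<in> edges G}"

lemma finite_verts: "simple_graph G \<Longrightarrow> finite (verts G)"
  by (simp add: simple_graph_def)

lemma finite_edges:
  assumes "simple_graph G"
  shows "finite (edges G)"
  by (rule finite_subset[of _ "Pow (verts G)"]) (use assms in \<open>auto simp: simple_graph_def\<close>)

lemma edgeD:
  assumes "simple_graph G" "{x, y} \<in> edges G"
  shows "x \<in> verts G" "y \<in> verts G" "x \<noteq> y"
proof -
  have "{x, y} \<subseteq> verts G" "card {x, y} = 2"
    using assms by (auto simp: simple_graph_def)
  then show "x \<in> verts G" "y \<in> verts G" "x \<noteq> y"
    by (auto simp: card_insert_if split: if_splits)
qed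

lemma finite_nbrs: "simple_graph G \<Longrightarrow> finite (nbrs G v)"
  by (simp add: nbrs_def finite_verts)

lemma subgraph_trans: "subgraph H G \<Longrightarrow> subgraph G K \<Longrightarrow> subgraph H K"
  by (auto simp: subgraph_def)

lemma sum_card_nbrs:
  assumes "simple_graph G"
  shows "(\<Sum>v\<in>verts G. card (nbrs G v)) = 2 * card (edges G)"
proof -
  have "card (nbrs G v) = card {e \<in> edges G. v \<in> e}" for v
  proof (rule bij_betw_same_card[where f = "\<lambda>u. {u, v}"])
    show "bij_betw (\<lambda>u. {u, v}) (nbrs G v) {e \<in> edges G. v \<in> e}"
    proof (rule bij_betw_imageI)
      show "inj_on (\<lambda>u. {u, v}) (nbrs G v)"
        by (auto simp: inj_on_def doubleton_eq_iff)
      show "(\<lambda>u. {u, v}) ` nbrs G v = {e \<in> edges G. v \<in> e}"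
      proof (intro equalityI subsetI)
        fix e assume "e \<in> {e \<in> edges G. v \<in> e}"
        then have e: "e \<in> edges G" "v \<in> e" by auto
        moreover from e assms obtain a b where "e = {a, b}"
          by (auto simp: simple_graph_def card_2_iff)
        ultimately obtain u where "e = {u, v}" by auto
        with e(1) edgeD(1)[OF assms, of u v] show "e \<in> (\<lambda>u. {u, v}) ` nbrs G v"
          by (auto simp: nbrs_def)
      qed (auto simp: nbrs_def)
    qed
  qed
  moreover have "(\<Sum>v\<in>verts G. card {e \<in> edges G. v \<in> e}) = 2 * card (edges G)"
  proof (rule sum_multicount)
    show "\<forall>e\<in>edges G. card {v \<in> verts G. v \<in> e} = 2"
    proof
      fix e assume "e \<in> edges G"
      then have "{v \<in> verts G. v \<in> e} = e" "card e = 2"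
        using assms by (auto simp: simple_graph_def)
      then show "card {v \<in> verts G. v \<in> e} = 2" by simp
    qed
  qed (rule finite_verts[OF assms] finite_edges[OF assms])+
  ultimately show ?thesis by simp
qed

text \<open>With the denominator multiplied out, the bound also covers the empty subgraph, which
  \<open>mad\<close> excludes. The work lies in the finiteness of the set of densities, without
  which \<open>Max\<close> says nothing.\<close>

lemma card_edges_le_mad:
  assumes "simple_graph G" "subgraph H G"
  shows "2 * real (card (edges H)) \<le> mad G * real (card (verts H))"
proof (cases "verts H = {}")
  case True
  with assms have "edges H = {}"
    by (auto simp: subgraph_def simple_graph_def)
  with True show ?thesis by simp
next
  case False
  let ?S = "{2 * real (card (edges H)) / real (card (verts H)) | H. subgraph H G \<and> verts H \<noteq> {}}"
  have "?S \<subseteq> (\<lambda>H. 2 * real (card (edges H)) / real (card (verts H))) ` (Pow (verts G) \<times> Pow (edges G))"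
    by (fastforce simp: subgraph_def)
  then have "finite ?S"
    by (rule finite_subset) (simp add: finite_verts finite_edges assms)
  then have "2 * real (card (edges H)) / real (card (verts H)) \<le> mad G"
    unfolding mad_def by (rule Max_ge) (use False assms in blast)
  moreover have "card (verts H) > 0"
    using False assms by (simp add: subgraph_def simple_graph_def card_gt_0_iff)
  ultimately show ?thesis by (simp add: divide_le_eq)
qed

lemma card_edges_le_nabla_half:
  assumes "simple_graph G" "simple_graph H" "le1_subdivision H H'" "subgraph H' G"
  shows "real (card (edges H)) \<le> nabla_half G * real (card (verts H))"
proof (cases "verts H = {}")
  case True
  with assms have "edges H = {}"
    by (auto simp: simple_graph_def)
  with True show ?thesis by simp
next
  case False
  let ?S = "{real (card (edges H)) / real (card (verts H)) | H.
    simple_graph H \<and> verts H \<noteq> {} \<and> (\<exists>H'. le1_subdivision H H' \<and> subgraph H' G)}"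
  \<comment> \<open>A graph with a subdivision inside \<open>G\<close> has its vertices in
    \<open>G\<close>, but its edges need not be edges of \<open>G\<close>; hence the double
    \<open>Pow\<close>.\<close>
  have "?S \<subseteq> (\<lambda>H. real (card (edges H)) / real (card (verts H))) ` (Pow (verts G) \<times> Pow (Pow (verts G)))"
  proof
    fix r assume "r \<in> ?S"
    then obtain K K' where K: "r = real (card (edges K)) / real (card (verts K))" "simple_graph K"
      "le1_subdivision K K'" "subgraph K' G" by blast
    then have "verts K \<subseteq> verts G"
      by (auto simp: le1_subdivision_def subgraph_def)
    moreover from this K(2) have "edges K \<subseteq> Pow (verts G)"
      by (auto simp: simple_graph_def)
    ultimately have "K \<in> Pow (verts G) \<times> Pow (Pow (verts G))"
      by (cases K) auto
    with K(1) show "r \<in> (\<lambda>H. real (card (edges H)) / real (card (verts H))) `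
      (Pow (verts G) \<times> Pow (Pow (verts G)))" by blast
  qed
  then have "finite ?S"
    by (rule finite_subset) (simp add: finite_verts assms)
  then have "real (card (edges H)) / real (card (verts H)) \<le> nabla_half G"
    unfolding nabla_half_def by (rule Max_ge) (use False assms in blast)
  moreover have "card (verts H) > 0"
    using False assms by (simp add: simple_graph_def card_gt_0_iff)
  ultimately show ?thesis by (simp add: divide_le_eq)
qed

subsection \<open>Light edges and defective choosability\<close>

text \<open>The recoloured vertex has no neighbour of its own colour, and its new colour cannot harm
  any neighbour. Bounding the defect only away from \<open>x\<close> lets the lemma serve both for a
  deleted vertex and for a deleted edge.\<close>

lemma has_defect_recolour:
  assumes "simple_graph G" and col: "col \<notin> c ` nbrs G x"
    and le: "\<And>u. u \<in> verts G - {x} \<Longrightarrow>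
      card {w \<in> verts G - {x}. {w, u} \<in> edges G \<and> c w = c u} \<le> d"
  shows "has_defect G (c(x := col)) d"
  unfolding has_defect_def
proof
  fix u assume u: "u \<in> verts G"
  let ?c = "c(x := col)"
  let ?U = "{w \<in> verts G. {w, u} \<in> edges G \<and> ?c w = ?c u}"
  show "card ?U \<le> d"
  proof (cases "u = x")
    case True
    have "?U = {}"
      using col True edgeD(3)[OF assms(1)] by (force simp: nbrs_def)
    then show ?thesis by (simp only: card.empty le0)
  next
    case False
    have "?U \<subseteq> {w \<in> verts G - {x}. {w, u} \<in> edges G \<and> c w = c u}"
      using col False u by (auto simp: nbrs_def insert_commute split: if_splits)
    then have "card ?U \<le> card {w \<in> verts G - {x}. {w, u} \<in> edges G \<and> c w = c u}"
      by (rule card_mono[rotated]) (simp add: finite_verts assms(1))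
    with le[of u] u False show ?thesis by simp
  qed
qed

text \<open>Induction on the number of vertices plus edges: delete a vertex of degree at most
  \<open>k\<close>, which is coloured last, or delete a light edge. The hypothesis ranges over all
  subgraphs and so passes to the smaller graph.\<close>

lemma choosable_if_low_degree_or_light_edge:
  assumes "simple_graph G"
    and "\<And>H. subgraph H G \<Longrightarrow> verts H \<noteq> {} \<Longrightarrow>
      (\<exists>v\<in>verts H. card (nbrs H v) \<le> k) \<or>
      (\<exists>x y. {x, y} \<in> edges H \<and> card (nbrs H x) \<le> d + k \<and> card (nbrs H y) \<le> d + k)"
  shows "choosable G (Suc k) d"
  unfolding choosable_def
proof (intro allI impI)
  fix L assume "list_assignment G (Suc k) L"
  with assms show "\<exists>c. list_colouring G L c \<and> has_defect G c d"
  proof (induction "card (verts G) + card (edges G)" arbitrary: G rule: less_induct)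
    case less
    note sG = less.prems(1) and L = less.prems(3)
    note fin = finite_verts[OF sG] finite_edges[OF sG]
    have IH: "\<exists>c. list_colouring H L c \<and> has_defect H c d"
      if "subgraph H G" "card (verts H) + card (edges H) < card (verts G) + card (edges G)" for H
    proof (rule less.hyps[OF that(2)])
      show "simple_graph H" using that(1) by (simp add: subgraph_def)
      show "list_assignment H (Suc k) L"
        using that(1) L by (auto simp: subgraph_def list_assignment_def)
    qed (use less.prems(2) subgraph_trans[OF _ that(1)] in blast)
    show ?case
    proof (cases "verts G = {}")
      case True
      then show ?thesis by (simp add: list_colouring_def has_defect_def)
    next
      case False
      have "subgraph G G" using sG by (simp add: subgraph_def)
      from less.prems(2)[OF this False]
      consider v where "v \<in> verts G" "card (nbrs G v) \<le> k"
        | x y where "{x, y} \<in> edges G" "card (nbrs G x) \<le> d + k" "card (nbrs G y) \<le> d + k"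
        by blast
      then show ?thesis
      proof cases
        case 1
        let ?H = "(verts G - {v}, {e \<in> edges G. v \<notin> e})"
        have "subgraph ?H G"
          using sG by (auto simp: subgraph_def simple_graph_def)
        moreover have "card (verts ?H) < card (verts G)"
          using card_Diff1_less[OF fin(1) 1(1)] by simp
        moreover have "card (edges ?H) \<le> card (edges G)"
          using fin by (auto intro: card_mono)
        ultimately obtain c where c: "list_colouring ?H L c" "has_defect ?H c d"
          using IH[of ?H] by auto
        have "card (c ` nbrs G v) < card (L v)"
          using card_image_le[OF finite_nbrs[OF sG], of c v] 1 L
          by (simp add: list_assignment_def)
        then obtain col where col: "col \<in> L v" "col \<notin> c ` nbrs G v"
          by (meson card_mono finite_imageI finite_nbrs linorder_not_less sG subsetI)
        have "has_defect G (c(v := col)) d"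
        proof (rule has_defect_recolour[OF sG col(2)])
          fix u assume u: "u \<in> verts G - {v}"
          have "{w \<in> verts G - {v}. {w, u} \<in> edges G \<and> c w = c u} =
            {w \<in> verts ?H. {w, u} \<in> edges ?H \<and> c w = c u}" using u by auto
          then show "card {w \<in> verts G - {v}. {w, u} \<in> edges G \<and> c w = c u} \<le> d"
            using c(2) u by (simp add: has_defect_def)
        qed
        moreover have "list_colouring G L (c(v := col))"
          using c(1) col by (auto simp: list_colouring_def)
        ultimately show ?thesis by blast
      next
        case (2 a b)
        let ?H = "(verts G, edges G - {{a, b}})"
        have "subgraph ?H G"
          using sG by (auto simp: subgraph_def simple_graph_def)
        moreover have "card (edges ?H) < card (edges G)"
          using card_Diff1_less[OF fin(2) 2(1)] by simp
        ultimately obtain c where c: "list_colouring ?H L c" "has_defect ?H c d"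
          using IH[of ?H] by auto
        show ?thesis
        proof (cases "has_defect G c d")
          case True
          with c(1) show ?thesis by (auto simp: list_colouring_def)
        next
          case False
          then obtain x where x: "x \<in> verts G"
            "d < card {w \<in> verts G. {w, x} \<in> edges G \<and> c w = c x}"
            by (auto simp: has_defect_def not_le)
          \<comment> \<open>Restoring the edge changes the neighbourhoods of its two ends
            only.\<close>
          have "x \<in> {a, b}"
          proof (rule ccontr)
            assume "x \<notin> {a, b}"
            then have "{w \<in> verts G. {w, x} \<in> edges G \<and> c w = c x} =
              {w \<in> verts ?H. {w, x} \<in> edges ?H \<and> c w = c x}" by auto
            with c(2) x show False by (auto simp: has_defect_def)
          qed
          then have deg: "card (nbrs G x) \<le> d + k" using 2 by auto
          let ?X = "{w \<in> nbrs G x. c w = c x}"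
          have "d < card ?X" using x(2) by (simp add: nbrs_def conj_assoc)
          moreover have "card (nbrs G x - ?X) = card (nbrs G x) - card ?X"
            by (rule card_Diff_subset) (auto simp: finite_nbrs sG)
          \<comment> \<open>At least \<open>d + 1\<close> of the at most \<open>d + k\<close>
            neighbours share the colour of \<open>x\<close>. The others block at most
            \<open>k - 1\<close> colours, so together with \<open>c x\<close> itself at most
            \<open>k\<close> of the \<open>Suc k\<close> colours in the list are lost.\<close>
          ultimately have "card (nbrs G x - ?X) < k"
            using deg card_mono[of "nbrs G x" ?X] finite_nbrs[OF sG, of x] by auto
          then have "card (c ` (nbrs G x - ?X)) < k"
            using card_image_le[of "nbrs G x - ?X" c] finite_nbrs[OF sG, of x] by auto
          then have "card (insert (c x) (c ` (nbrs G x - ?X))) < Suc k"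
            using finite_nbrs[OF sG, of x] by (simp add: card_insert_if)
          also have "Suc k = card (L x)"
            using L x by (simp add: list_assignment_def)
          finally have "\<not> L x \<subseteq> insert (c x) (c ` (nbrs G x - ?X))"
            using card_mono[of "insert (c x) (c ` (nbrs G x - ?X))" "L x"] finite_nbrs[OF sG, of x]
            by auto
          then obtain col where col: "col \<in> L x" "col \<notin> insert (c x) (c ` (nbrs G x - ?X))"
            by blast
          have col': "col \<notin> c ` nbrs G x" using col(2) by auto
          have "has_defect G (c(x := col)) d"
          proof (rule has_defect_recolour[OF sG col'])
            fix u assume u: "u \<in> verts G - {x}"
            \<comment> \<open>The deleted edge has \<open>x\<close> as an end, so every edge counted
              here survives in \<open>?H\<close>.\<close>
            have "{w \<in> verts G - {x}. {w, u} \<in> edges G \<and> c w = c u} \<subseteq>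
              {w \<in> verts ?H. {w, u} \<in> edges ?H \<and> c w = c u}"
              using u \<open>x \<in> {a, b}\<close> by (auto simp: doubleton_eq_iff)
            then have "card {w \<in> verts G - {x}. {w, u} \<in> edges G \<and> c w = c u} \<le>
              card {w \<in> verts ?H. {w, u} \<in> edges ?H \<and> c w = c u}"
              by (rule card_mono[rotated]) (simp add: fin)
            also have "\<dots> \<le> d" using c(2) u by (simp add: has_defect_def)
            finally show "card {w \<in> verts G - {x}. {w, u} \<in> edges G \<and> c w = c u} \<le> d" .
          qed
          moreover have "list_colouring G L (c(x := col))"
            using c(1) col by (auto simp: list_colouring_def)
          ultimately show ?thesis by blast
        qed
      qed
    qed
  qed
qed

subsection \<open>Cliques in degenerate graphs\<close>

text \<open>Here \<open>M\<close> is the edge set of a graph whose vertex set contains \<open>W\<close>.\<close>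

definition cliques :: "'a set set \<Rightarrow> 'a set \<Rightarrow> nat \<Rightarrow> 'a set set" where
  "cliques M W k = {S. S \<subseteq> W \<and> card S = k \<and> (\<forall>e. e \<subseteq> S \<and> card e = 2 \<longrightarrow> e \<in> M)}"

lemma finite_cliques: "finite W \<Longrightarrow> finite (cliques M W k)"
  by (rule finite_subset[of _ "Pow W"]) (auto simp: cliques_def)

text \<open>Remove a vertex \<open>v\<close> with at most \<open>D\<close> neighbours: each clique
  of size \<open>Suc k\<close> through \<open>v\<close> is determined by \<open>k\<close> of these
  neighbours, so each removal costs at most \<open>D choose k\<close> cliques.\<close>

lemma card_cliques_le:
  assumes "finite W"
    and "\<And>U. U \<subseteq> W \<Longrightarrow> U \<noteq> {} \<Longrightarrow> \<exists>v\<in>U. card {u \<in> U. u \<noteq> v \<and> {u, v} \<in> M} \<le> D"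
  shows "card (cliques M W (Suc k)) \<le> card W * (D choose k)"
  using assms
proof (induction "card W" arbitrary: W)
  case 0
  then have "cliques M W (Suc k) = {}" by (auto simp: cliques_def)
  then show ?case by simp
next
  case (Suc n)
  then have "W \<noteq> {}" by auto
  with Suc.prems(2)[of W] obtain v where v: "v \<in> W" "card {u \<in> W. u \<noteq> v \<and> {u, v} \<in> M} \<le> D"
    by blast
  let ?W = "W - {v}" and ?N = "{u \<in> W. u \<noteq> v \<and> {u, v} \<in> M}"
  have n: "card ?W = n" using Suc.hyps(2) v Suc.prems(1) by simp
  have IH: "card (cliques M ?W (Suc k)) \<le> card ?W * (D choose k)"
    by (rule Suc.hyps(1)) (use n Suc.prems in auto)
  have sub: "cliques M W (Suc k) \<subseteq> cliques M ?W (Suc k) \<union> insert v ` {T. T \<subseteq> ?N \<and> card T = k}"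
  proof
    fix S assume S: "S \<in> cliques M W (Suc k)"
    show "S \<in> cliques M ?W (Suc k) \<union> insert v ` {T. T \<subseteq> ?N \<and> card T = k}"
    proof (cases "v \<in> S")
      case False
      with S show ?thesis by (auto simp: cliques_def)
    next
      case True
      have "finite S" using S Suc.prems(1) by (auto simp: cliques_def finite_subset)
      have "S - {v} \<subseteq> ?N"
      proof
        fix u assume u: "u \<in> S - {v}"
        then have "{u, v} \<subseteq> S" "card {u, v} = 2" using True by auto
        then have "{u, v} \<in> M" using S by (auto simp: cliques_def)
        with u S show "u \<in> ?N" by (auto simp: cliques_def)
      qed
      moreover have "card (S - {v}) = k" using S True \<open>finite S\<close> by (simp add: cliques_def)
      moreover have "S = insert v (S - {v})" using True by auto
      ultimately show ?thesis by blast
    qed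
  qed
  have finN: "finite {T. T \<subseteq> ?N \<and> card T = k}" using Suc.prems(1) by simp
  have "card (insert v ` {T. T \<subseteq> ?N \<and> card T = k}) \<le> card {T. T \<subseteq> ?N \<and> card T = k}"
    using finN by (rule card_image_le)
  also have "\<dots> = card ?N choose k" using Suc.prems(1) by (simp add: n_subsets)
  also have "\<dots> \<le> D choose k" using v(2) by (rule binomial_right_mono)
  finally have new: "card (insert v ` {T. T \<subseteq> ?N \<and> card T = k}) \<le> D choose k" .
  have "card (cliques M W (Suc k)) \<le>
      card (cliques M ?W (Suc k)) + card (insert v ` {T. T \<subseteq> ?N \<and> card T = k})"
    using card_mono[OF _ sub] card_Un_le[of "cliques M ?W (Suc k)" "insert v ` {T. T \<subseteq> ?N \<and> card T = k}"]
      finite_cliques[of ?W M "Suc k"] finN Suc.prems(1)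
    by (meson finite_Diff finite_UnI finite_imageI order_trans)
  with IH new have "card (cliques M W (Suc k)) \<le> Suc n * (D choose k)" by (simp add: n)
  then show ?case using Suc.hyps(2) by simp
qed

subsection \<open>Routing pairs through an independent set\<close>

text \<open>The graph \<open>(B, M)\<close> is subdivided inside \<open>G\<close>, with \<open>m e \<in> A\<close> as the subdivision vertex of \<open>e\<close>.\<close>

definition routing :: "'a ugraph \<Rightarrow> 'a set \<Rightarrow> 'a set \<Rightarrow> 'a set set \<Rightarrow> ('a set \<Rightarrow> 'a) \<Rightarrow> bool" where
  "routing G A B M m \<longleftrightarrow> (\<forall>e\<in>M. e \<subseteq> B \<and> card e = 2) \<and> inj_on m M \<and> m ` M \<subseteq> A \<and>
     (\<forall>e\<in>M. \<forall>x\<in>e. {x, m e} \<in> edges G)"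

lemma routing_finite:
  assumes "routing G A B M m" "finite B"
  shows "finite M"
  by (rule finite_subset[of _ "Pow B"]) (use assms in \<open>auto simp: routing_def\<close>)

lemma routing_restrict:
  "routing G A B M m \<Longrightarrow> routing G A U {e \<in> M. e \<subseteq> U} m"
  unfolding routing_def by (auto intro: inj_on_subset)

lemma obtain_maximal_routing:
  assumes "finite A" "finite B"
  obtains M m where "routing G A B M m"
    and "\<And>v. v \<in> A - m ` M \<Longrightarrow> nbrs G v \<subseteq> B \<Longrightarrow> card (nbrs G v) \<ge> s \<Longrightarrow>
      \<exists>S\<in>cliques M B s. S \<subseteq> nbrs G v"
proof -
  let ?P = "\<lambda>n. \<exists>M m. routing G A B M m \<and> card M = n"
  have "?P 0" by (rule exI[of _ "{}"]) (simp add: routing_def)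
  moreover have "n \<le> card A" if "?P n" for n
    using that card_inj_on_le[OF _ _ assms(1)] by (auto simp: routing_def)
  ultimately obtain n where n: "?P n" "\<And>n'. ?P n' \<Longrightarrow> n' \<le> n"
    using Nat.ex_has_greatest_nat[of ?P 0 "card A"] by blast
  then obtain M m where M: "routing G A B M m" "card M = n" by blast
  note finM = routing_finite[OF M(1) assms(2)]
  show thesis
  proof (rule that[OF M(1)])
    fix v assume v: "v \<in> A - m ` M" "nbrs G v \<subseteq> B" "card (nbrs G v) \<ge> s"
    have "e \<in> M" if e: "e \<subseteq> nbrs G v" "card e = 2" for e
    proof (rule ccontr)
      assume "e \<notin> M"
      then have "routing G A B (insert e M) (m(e := v))"
        using M(1) v e by (auto simp: routing_def nbrs_def inj_on_def split: if_splits)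
      moreover have "card (insert e M) = Suc n" using \<open>e \<notin> M\<close> finM M(2) by simp
      ultimately have "Suc n \<le> n" using n(2) by blast
      then show False by simp
    qed
    moreover obtain S where "S \<subseteq> nbrs G v" "card S = s"
      using obtain_subset_with_card_n[OF v(3)] by metis
    ultimately show "\<exists>S\<in>cliques M B s. S \<subseteq> nbrs G v"
      using v(2) by (intro bexI[of _ S]) (auto simp: cliques_def)
  qed
qed

text \<open>Subdividing every edge of the graph \<open>(B, M)\<close>, with \<open>m e\<close> as
  the new vertex on \<open>e\<close>, gives a subgraph of \<open>G\<close>.\<close>

lemma card_routing_le:
  assumes "simple_graph G" "routing G A B M m" "A \<subseteq> verts G" "B \<subseteq> verts G" "A \<inter> B = {}"
  shows "real (card M) \<le> nabla_half G * real (card B)"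
proof -
  note r = assms(2)[unfolded routing_def]
  let ?H' = "(B \<union> m ` M, {{x, m e} | x e. e \<in> M \<and> x \<in> e})"
  have finB: "finite B" using assms finite_subset finite_verts by metis
  have "simple_graph (B, M)" using r finB by (auto simp: simple_graph_def)
  moreover have "le1_subdivision (B, M) ?H'"
    unfolding le1_subdivision_def
    by (rule exI[of _ M], rule exI[of _ m]) (use r assms(5) in auto)
  moreover have "subgraph ?H' G"
  proof -
    have "card {x, m e} = 2" if "e \<in> M" "x \<in> e" for x e
    proof -
      have "x \<in> B" "m e \<in> A" using r that by auto
      with assms(5) have "x \<noteq> m e" by auto
      then show ?thesis by simp
    qed
    then show ?thesis
      unfolding subgraph_def simple_graph_def
      using r assms(3,4) finB routing_finite[OF assms(2) finB] by auto
  qed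
  ultimately have "real (card (edges (B, M))) \<le> nabla_half G * real (card (verts (B, M)))"
    using card_edges_le_nabla_half[OF assms(1)] by blast
  then show ?thesis by simp
qed

lemma nabla_half_nonneg:
  assumes "simple_graph G" "verts G \<noteq> {}"
  shows "nabla_half G \<ge> 0"
proof -
  \<comment> \<open>The edgeless graph on all vertices has density 0.\<close>
  have "routing G {} (verts G) {} (\<lambda>_. undefined)" by (simp add: routing_def)
  from card_routing_le[OF assms(1) this] have "0 \<le> nabla_half G * real (card (verts G))" by simp
  moreover have "card (verts G) > 0" using assms(2) finite_verts[OF assms(1)] by (simp add: card_gt_0_iff)
  ultimately show ?thesis by (simp add: zero_le_mult_iff)
qed

text \<open>The pairs inside \<open>U\<close> are again routed, so the graph they form on
  \<open>U\<close> has average degree at most \<open>2 * nabla_half G\<close>. Some vertex does not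
  exceed the average, and degrees being integers justifies the floor.\<close>

lemma routing_degenerate:
  assumes "simple_graph G" "routing G A B M m" "A \<subseteq> verts G" "B \<subseteq> verts G" "A \<inter> B = {}"
    and "U \<subseteq> B" "U \<noteq> {}"
  shows "\<exists>v\<in>U. card {u \<in> U. u \<noteq> v \<and> {u, v} \<in> M} \<le> nat \<lfloor>2 * nabla_half G\<rfloor>"
proof (rule ccontr)
  assume "\<not> ?thesis"
  then have gt: "nat \<lfloor>2 * nabla_half G\<rfloor> < card {u \<in> U. u \<noteq> v \<and> {u, v} \<in> M}" if "v \<in> U" for v
    using that by force
  let ?M = "{e \<in> M. e \<subseteq> U}"
  let ?K = "(U, ?M)"
  have U: "finite U" "U \<subseteq> verts G"
    using assms(4,6) finite_subset[OF _ finite_verts[OF assms(1)], of U] by auto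
  have r: "routing G A U ?M m" using assms(2) by (rule routing_restrict)
  have K: "simple_graph ?K" using r U by (auto simp: simple_graph_def routing_def)
  have "2 * nabla_half G < card (nbrs ?K v)" if "v \<in> U" for v
  proof -
    have "{u \<in> U. u \<noteq> v \<and> {u, v} \<in> M} \<subseteq> nbrs ?K v" using that by (auto simp: nbrs_def)
    then have "card {u \<in> U. u \<noteq> v \<and> {u, v} \<in> M} \<le> card (nbrs ?K v)"
      by (rule card_mono[OF finite_nbrs[OF K]])
    with gt[OF that] show ?thesis by linarith
  qed
  then have "(\<Sum>v\<in>U. 2 * nabla_half G) < (\<Sum>v\<in>U. real (card (nbrs ?K v)))"
    using U assms(7) by (intro sum_strict_mono)
  also have "\<dots> = real (\<Sum>v\<in>verts ?K. card (nbrs ?K v))" by simp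
  also have "\<dots> = 2 * real (card ?M)" unfolding sum_card_nbrs[OF K] by simp
  also have "\<dots> \<le> 2 * (nabla_half G * real (card U))"
    using card_routing_le[OF assms(1) r assms(3) U(2)] assms(5,6) by auto
  finally show False by simp
qed

section \<open>Copies of \<open>K_star\<close> and the size of the independent set\<close>

lemma inj_on_UnI:
  "inj_on f A \<Longrightarrow> inj_on f B \<Longrightarrow> f ` A \<inter> f ` B = {} \<Longrightarrow> inj_on f (A \<union> B)"
  by (auto simp: inj_on_Un)

text \<open>The clique \<open>S\<close> is the side of size \<open>s\<close>, vertices of
  \<open>T\<close> form the other side, and the routing vertex of a pair in \<open>S\<close> plays
  its added vertex. These three kinds of vertices lie in the disjoint sets \<open>B\<close>,
  \<open>A - m\<close> M\<open>and\<close>m \<open>M\<close>, so injectivity can be checked on each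
  kind separately.\<close>

lemma contains_K_star:
  assumes "routing G A B M m" "A \<subseteq> verts G" "B \<subseteq> verts G" "A \<inter> B = {}" "finite B"
    and "S \<in> cliques M B s" "T \<subseteq> A - m ` M" "finite T" "card T \<ge> t"
    and adj: "\<And>v. v \<in> T \<Longrightarrow> S \<subseteq> nbrs G v"
  shows "contains_copy G (K_star s t)"
proof -
  have S: "S \<subseteq> B" "card S = s" "\<And>e. e \<subseteq> S \<Longrightarrow> card e = 2 \<Longrightarrow> e \<in> M"
    using assms(6) by (auto simp: cliques_def)
  have "finite S" using S(1) assms(5) finite_subset by blast
  then obtain \<sigma> where \<sigma>: "bij_betw \<sigma> {..<s} S"
    using ex_bij_betw_nat_finite[of S] S(2) by (auto simp: atLeast0LessThan)
  obtain T' where T': "T' \<subseteq> T" "card T' = t" "finite T'"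
    using obtain_subset_with_card_n[OF assms(9)] by metis
  then obtain \<tau> where \<tau>: "bij_betw \<tau> {..<t} T'"
    using ex_bij_betw_nat_finite[of T'] by (auto simp: atLeast0LessThan)
  have \<tau>T: "\<tau> j \<in> T" if "j < t" for j
    using \<tau> T' that by (auto simp: bij_betw_def)
  have \<sigma>S: "\<sigma> i \<in> S" if "i < s" for i
    using \<sigma> that by (auto simp: bij_betw_def)
  define f where "f v = (case v of PartS i \<Rightarrow> \<sigma> i | PartT j \<Rightarrow> \<tau> j | PairV p \<Rightarrow> m (\<sigma> ` p))" for v
  have f: "f (PartS i) = \<sigma> i" "f (PartT j) = \<tau> j" "f (PairV p) = m (\<sigma> ` p)" for i j p
    by (simp_all add: f_def)
  have pM: "\<sigma> ` p \<in> M" if "p \<subseteq> {..<s}" "card p = 2" for p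
  proof (rule S(3))
    show "\<sigma> ` p \<subseteq> S" using that \<sigma>S by auto
    show "card (\<sigma> ` p) = 2"
      using that \<sigma> card_image[of \<sigma> p] by (metis bij_betw_def inj_on_subset)
  qed
  have inj_pairs: "p = q" if "p \<subseteq> {..<s}" "q \<subseteq> {..<s}" "\<sigma> ` p = \<sigma> ` q" for p q
    using that \<sigma> by (metis bij_betw_def inj_on_image_eq_iff)
  let ?V = "verts (K_star s t)"
  have V: "?V = PartS ` {..<s} \<union> PartT ` {..<t} \<union> PairV ` {p. p \<subseteq> {..<s} \<and> card p = 2}"
    by (simp add: K_star_def)
  have r: "inj_on m M" "m ` M \<subseteq> A" "\<And>e x. e \<in> M \<Longrightarrow> x \<in> e \<Longrightarrow> {x, m e} \<in> edges G"
    using assms(1) by (auto simp: routing_def)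
  have inB: "\<sigma> i \<in> B" if "i < s" for i using \<sigma>S[OF that] S(1) by blast
  have inA: "\<tau> j \<in> A" "\<tau> j \<notin> m ` M" if "j < t" for j using \<tau>T[OF that] assms(7) by auto
  have inA': "m (\<sigma> ` p) \<in> A" "m (\<sigma> ` p) \<in> m ` M" if "p \<subseteq> {..<s}" "card p = 2" for p
    using pM[OF that] r(2) by auto
  have "inj_on f ?V"
  proof -
    have 1: "inj_on f (PartS ` {..<s})"
      using \<sigma> by (auto simp: inj_on_def f bij_betw_def)
    have 2: "inj_on f (PartT ` {..<t})"
      using \<tau> by (auto simp: inj_on_def f bij_betw_def)
    have 3: "inj_on f (PairV ` {p. p \<subseteq> {..<s} \<and> card p = 2})"
    proof (rule inj_onI)
      fix x y
      assume "x \<in> PairV ` {p. p \<subseteq> {..<s} \<and> card p = 2}" "y \<in> PairV ` {p. p \<subseteq> {..<s} \<and> card p = 2}"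
        and eq: "f x = f y"
      then obtain p q where pq: "x = PairV p" "y = PairV q" "p \<subseteq> {..<s}" "card p = 2"
        "q \<subseteq> {..<s}" "card q = 2" by auto
      with eq have "\<sigma> ` p = \<sigma> ` q" using r(1) pM by (auto simp: f inj_on_def)
      with pq inj_pairs show "x = y" by auto
    qed
    have 4: "f ` (PartS ` {..<s}) \<subseteq> B"
      unfolding image_image f using inB by auto
    have 5: "f ` (PartT ` {..<t}) \<subseteq> A - m ` M"
      unfolding image_image f by (intro image_subsetI DiffI inA) auto
    have 6: "f ` (PairV ` {p. p \<subseteq> {..<s} \<and> card p = 2}) \<subseteq> m ` M"
      unfolding image_image f by (intro image_subsetI inA'(2)) auto
    have 7: "inj_on f (PartS ` {..<s} \<union> PartT ` {..<t})"
    proof (rule inj_on_UnI[OF 1 2])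
      have "B \<inter> (A - m ` M) = {}" using assms(4) by blast
      with Int_mono[OF 4 5] show "f ` (PartS ` {..<s}) \<inter> f ` (PartT ` {..<t}) = {}"
        by (simp only: subset_empty)
    qed
    have 8: "f ` (PartS ` {..<s} \<union> PartT ` {..<t}) \<subseteq> B \<union> (A - m ` M)"
      unfolding image_Un[of f] using 4 5 by (rule Un_mono)
    show ?thesis
      unfolding V
    proof (rule inj_on_UnI[OF 7 3])
      have "(B \<union> (A - m ` M)) \<inter> m ` M = {}" using assms(4) r(2) by blast
      with Int_mono[OF 8 6] show "f ` (PartS ` {..<s} \<union> PartT ` {..<t}) \<inter>
          f ` (PairV ` {p. p \<subseteq> {..<s} \<and> card p = 2}) = {}"
        by (simp only: subset_empty)
    qed
  qed
  moreover have "f ` ?V \<subseteq> verts G"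
    unfolding V image_Un image_image f
    by (intro Un_least image_subsetI subsetD[OF assms(2)] subsetD[OF assms(3)] inB inA inA') auto
  moreover have "f ` e \<in> edges G" if e: "e \<in> edges (K_star s t)" for e
  proof -
    from e consider i j where "e = {PartS i, PartT j}" "i < s" "j < t"
      | i p where "e = {PartS i, PairV p}" "p \<subseteq> {..<s}" "card p = 2" "i \<in> p"
      by (auto simp: K_star_def)
    then show ?thesis
    proof cases
      case 1
      then show ?thesis using adj[OF \<tau>T] \<sigma>S by (fastforce simp: f nbrs_def)
    next
      case 2
      then show ?thesis using r(3)[OF pM] by (simp add: f)
    qed
  qed
  ultimately show ?thesis unfolding contains_copy_def by blast
qed

text \<open>Charge each unrouted vertex to a clique in its neighbourhood; \<open>t\<close> vertices
  charged to the same clique would complete a copy of \<open>K_star s t\<close>.\<close>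

lemma card_unrouted_le:
  assumes "routing G A B M m" "A \<subseteq> verts G" "B \<subseteq> verts G" "A \<inter> B = {}" "finite A" "finite B"
    and "\<not> contains_copy G (K_star s t)"
    and "\<And>v. v \<in> A - m ` M \<Longrightarrow> \<exists>S\<in>cliques M B s. S \<subseteq> nbrs G v"
  shows "card (A - m ` M) \<le> card (cliques M B s) * (t - 1)"
proof -
  let ?F = "\<lambda>S. {v \<in> A - m ` M. S \<subseteq> nbrs G v}"
  have "A - m ` M \<subseteq> (\<Union>S\<in>cliques M B s. ?F S)" using assms(8) by blast
  then have "card (A - m ` M) \<le> card (\<Union>S\<in>cliques M B s. ?F S)"
    by (rule card_mono[rotated]) (use assms(5) finite_cliques[OF assms(6)] in auto)
  also have "\<dots> \<le> (\<Sum>S\<in>cliques M B s. card (?F S))"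
    by (rule card_UN_le) (simp add: finite_cliques assms(6))
  also have "\<dots> \<le> (\<Sum>S\<in>cliques M B s. t - 1)"
  proof (rule sum_mono)
    fix S assume S: "S \<in> cliques M B s"
    have "\<not> t \<le> card (?F S)"
    proof
      assume t: "t \<le> card (?F S)"
      have "contains_copy G (K_star s t)"
        by (rule contains_K_star[OF assms(1-4,6) S _ _ t]) (use assms(5) in auto)
      with assms(7) show False by contradiction
    qed
    then show "card (?F S) \<le> t - 1" by simp
  qed
  finally show ?thesis by simp
qed

lemma contains_copy_subgraph:
  "contains_copy H K \<Longrightarrow> subgraph H G \<Longrightarrow> contains_copy G K"
  unfolding contains_copy_def subgraph_def by (meson subsetD subset_trans)

text \<open>Split \<open>A\<close> into routed vertices, as many as edges in \<open>M\<close>, and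
  unrouted ones, at most \<open>t - 1\<close> per \<open>s\<close>-clique. For \<open>s = 2\<close>
  the cliques are edges of \<open>M\<close>, so \<open>card M\<close> bounds their number directly;
  for larger \<open>s\<close> degeneracy does. This is the origin of the case distinction in
  \<open>N1\<close>.\<close>

lemma card_independent_le:
  assumes G: "simple_graph G" "subgraph H G" "\<not> contains_copy G (K_star s t)" and "s \<ge> 2" "t \<ge> 1"
    and AB: "A \<subseteq> verts H" "B \<subseteq> verts H" "A \<inter> B = {}"
    and nb: "\<And>v. v \<in> A \<Longrightarrow> nbrs H v \<subseteq> B" "\<And>v. v \<in> A \<Longrightarrow> s \<le> card (nbrs H v)"
  shows "real (card A) \<le> (if s = 2 then nabla_half G * real t
    else real (nat \<lfloor>2 * nabla_half G\<rfloor> choose (s - 1)) * (real t - 1) + nabla_half G) * real (card B)"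
proof -
  have fin: "finite A" "finite B"
    using AB G(2) by (meson finite_subset finite_verts subgraph_def)+
  obtain M m where M: "routing H A B M m"
    and "\<And>v. v \<in> A - m ` M \<Longrightarrow> nbrs H v \<subseteq> B \<Longrightarrow> card (nbrs H v) \<ge> s \<Longrightarrow>
      \<exists>S\<in>cliques M B s. S \<subseteq> nbrs H v"
    using obtain_maximal_routing[OF fin] by blast
  then have cl: "\<exists>S\<in>cliques M B s. S \<subseteq> nbrs H v" if "v \<in> A - m ` M" for v
    using nb that by blast
  \<comment> \<open>The routing was chosen in \<open>H\<close>, where neighbourhoods of
    \<open>A\<close> stay inside \<open>B\<close>; viewed in \<open>G\<close>, it is subject to the
    density of \<open>G\<close>.\<close>
  have MG: "routing G A B M m" "A \<subseteq> verts G" "B \<subseteq> verts G"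
    using M AB G(2) by (auto simp: routing_def subgraph_def)
  note finM = routing_finite[OF M fin(2)]
  have le_M: "real (card M) \<le> nabla_half G * real (card B)"
    by (rule card_routing_le[OF G(1) MG AB(3)])
  have "\<not> contains_copy H (K_star s t)"
    using G contains_copy_subgraph by blast
  then have "card (A - m ` M) \<le> card (cliques M B s) * (t - 1)"
    using card_unrouted_le[OF M AB fin _ cl] by blast
  then have "real (card (A - m ` M)) \<le> real (card (cliques M B s) * (t - 1))"
    by (simp only: of_nat_le_iff)
  then have rest: "real (card (A - m ` M)) \<le> real (card (cliques M B s)) * (real t - 1)"
    using \<open>t \<ge> 1\<close> by (simp add: of_nat_diff)
  have "card A = card M + card (A - m ` M)"
  proof -
    have "card (m ` M) = card M" "m ` M \<subseteq> A"
      using M by (auto simp: routing_def card_image)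
    then show ?thesis using card_Diff_subset[of "m ` M" A] finM card_mono[OF fin(1), of "m ` M"] by simp
  qed
  then have A: "real (card A) \<le>
      nabla_half G * real (card B) + real (card (cliques M B s)) * (real t - 1)"
    using rest le_M by linarith
  show ?thesis
  proof (cases "s = 2")
    case True
    have "cliques M B 2 \<subseteq> M" by (auto simp: cliques_def)
    then have "card (cliques M B 2) \<le> card M" by (rule card_mono[OF finM])
    with le_M have "real (card (cliques M B 2)) \<le> nabla_half G * real (card B)" by linarith
    then have "real (card (cliques M B 2)) * (real t - 1) \<le> nabla_half G * real (card B) * (real t - 1)"
      using \<open>t \<ge> 1\<close> by (intro mult_right_mono) auto
    with A True show ?thesis by (simp add: algebra_simps)
  next
    case False
    have "card (cliques M B (Suc (s - 1))) \<le> card B * (nat \<lfloor>2 * nabla_half G\<rfloor> choose (s - 1))"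
      by (rule card_cliques_le[OF fin(2)]) (rule routing_degenerate[OF G(1) MG AB(3)])
    then have "real (card (cliques M B s)) \<le> real (card B) * real (nat \<lfloor>2 * nabla_half G\<rfloor> choose (s - 1))"
      using \<open>s \<ge> 2\<close> by (metis Suc_diff_1 gr_zeroI not_numeral_le_zero of_nat_le_iff of_nat_mult)
    then have "real (card (cliques M B s)) * (real t - 1) \<le>
        real (card B) * real (nat \<lfloor>2 * nabla_half G\<rfloor> choose (s - 1)) * (real t - 1)"
      using \<open>t \<ge> 1\<close> by (intro mult_right_mono) auto
    with A False show ?thesis by (simp add: algebra_simps)
  qed
qed

subsection \<open>Existence of light edges\<close>

lemma degree_less_if_no_K_star_1:
  assumes "simple_graph G" "\<not> contains_copy G (K_star 1 t)" "v \<in> verts G"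
  shows "card (nbrs G v) < t"
proof (rule ccontr)
  assume "\<not> ?thesis"
  then have t: "card (nbrs G v) \<ge> t" by simp
  \<comment> \<open>\<open>K_star 1 t\<close> is a star without pair vertices, so an empty routing
    and the one-vertex clique at \<open>v\<close> suffice.\<close>
  have r: "routing G (verts G - {v}) {v} {} (\<lambda>_. undefined)" by (simp add: routing_def)
  have cl: "{v} \<in> cliques {} {v} 1"
    by (auto simp: cliques_def dest: card_mono[rotated])
  have "contains_copy G (K_star 1 t)"
    by (rule contains_K_star[OF r _ _ _ _ cl, where T = "nbrs G v"])
      (use assms(3) t edgeD(3)[OF assms(1)] finite_nbrs[OF assms(1)] in
        \<open>auto simp: nbrs_def insert_commute[of v]\<close>)
  with assms(2) show False by simp
qed

lemma light_edge:
  assumes G: "simple_graph G" "\<not> contains_copy G (K_star s t)" and "s \<ge> 1" "t \<ge> 1"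
    and H: "subgraph H G" "verts H \<noteq> {}"
    and deg: "\<And>v. v \<in> verts H \<Longrightarrow> s \<le> card (nbrs H v)"
  defines "l \<equiv> N1 s t (mad G) (2 * nabla_half G)"
  shows "\<exists>x y. {x, y} \<in> edges H \<and> real (card (nbrs H x)) \<le> l \<and> real (card (nbrs H y)) \<le> l"
proof (rule ccontr)
  assume no: "\<not> ?thesis"
  have simpH: "simple_graph H" using H by (simp add: subgraph_def)
  show False
  proof (cases "s = 1")
    case True
    \<comment> \<open>Here \<open>l = t - 1\<close> and all degrees are below \<open>t\<close>, so
      any edge is light.\<close>
    obtain v where v: "v \<in> verts H" using H by blast
    with deg[of v] \<open>s \<ge> 1\<close> have "nbrs H v \<noteq> {}" by auto
    then obtain u where uv: "{u, v} \<in> edges H" by (auto simp: nbrs_def)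
    have "\<not> contains_copy H (K_star 1 t)"
      using G(2) H(1) contains_copy_subgraph True by blast
    then have "card (nbrs H x) < t" if "x \<in> verts H" for x
      using degree_less_if_no_K_star_1[OF simpH] that by blast
    then have "real (card (nbrs H x)) \<le> l" if "x \<in> verts H" for x
      using True that by (force simp: l_def N1_def)
    with no uv edgeD[OF simpH uv] show False by blast
  next
    case False
    then have s2: "s \<ge> 2" using \<open>s \<ge> 1\<close> by simp
    let ?\<delta> = "mad G" and ?\<nu> = "nabla_half G"
    define A where "A = {v \<in> verts H. real (card (nbrs H v)) \<le> l}"
    define B where "B = verts H - A"
    \<comment> \<open>This is the ratio bounding \<open>card A\<close> by \<open>card B\<close>;
      \<open>N1\<close> is built from it as \<open>(\<delta> - s) * c + \<delta>\<close>.\<close>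
    define c where "c = (if s = 2 then ?\<nu> * real t
      else real (nat \<lfloor>2 * ?\<nu>\<rfloor> choose (s - 1)) * (real t - 1) + ?\<nu>)"
    have l: "l = (?\<delta> - real s) * c + ?\<delta>"
      using s2 by (simp add: l_def N1_def c_def)
    have AB: "A \<subseteq> verts H" "B \<subseteq> verts H" "A \<inter> B = {}" "A \<union> B = verts H"
      by (auto simp: A_def B_def)
    have fin: "finite A" "finite B"
      using AB finite_verts[OF simpH] by (meson finite_subset)+
    have cardV: "card (verts H) = card A + card B"
      using card_Un_disjoint[OF fin AB(3)] AB(4) by simp
    have V0: "card (verts H) > 0" using H(2) finite_verts[OF simpH] by (simp add: card_gt_0_iff)
    have "verts G \<noteq> {}" using H by (auto simp: subgraph_def)
    then have \<nu>: "?\<nu> \<ge> 0" by (rule nabla_half_nonneg[OF G(1)])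
    then have c0: "c \<ge> 0" using \<open>t \<ge> 1\<close> by (auto simp: c_def)
    have sum: "(\<Sum>v\<in>verts H. real (card (nbrs H v))) \<le> ?\<delta> * real (card (verts H))"
      using card_edges_le_mad[OF G(1) H(1)] sum_card_nbrs[OF simpH]
      by (metis of_nat_mult of_nat_numeral of_nat_sum)
    have "real s * real (card (verts H)) \<le> (\<Sum>v\<in>verts H. real (card (nbrs H v)))"
      using sum_mono[of "verts H" "\<lambda>_. real s" "\<lambda>v. real (card (nbrs H v))"] deg
      by (simp add: mult.commute)
    with sum have "real s * real (card (verts H)) \<le> ?\<delta> * real (card (verts H))" by linarith
    then have \<delta>: "real s \<le> ?\<delta>" using V0 by simp
    have nbA: "nbrs H v \<subseteq> B" if v: "v \<in> A" for v
    proof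
      fix u assume u: "u \<in> nbrs H v"
      then have "{u, v} \<in> edges H" "u \<in> verts H" by (auto simp: nbrs_def)
      with no v have "u \<notin> A" by (auto simp: A_def)
      with \<open>u \<in> verts H\<close> show "u \<in> B" by (simp add: B_def)
    qed
    \<comment> \<open>Needed for strictness when the degrees over \<open>B\<close>, each above
      \<open>l\<close>, are summed.\<close>
    have "B \<noteq> {}"
    proof
      assume "B = {}"
      with AB H(2) obtain v where "v \<in> A" by auto
      with nbA \<open>B = {}\<close> have "nbrs H v = {}" by auto
      with deg[of v] \<open>v \<in> A\<close> AB(1) s2 show False by auto
    qed
    have A_le: "real (card A) \<le> c * real (card B)"
      unfolding c_def
      by (rule card_independent_le[OF G(1) H(1) G(2) s2 \<open>t \<ge> 1\<close> AB(1-3) nbA])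
        (use deg AB(1) in auto)
    have "real s * real (card A) \<le> (\<Sum>v\<in>A. real (card (nbrs H v)))"
      using sum_mono[of A "\<lambda>_. real s" "\<lambda>v. real (card (nbrs H v))"] deg AB(1)
      by (auto simp: mult.commute)
    moreover have "(\<Sum>v\<in>B. l) < (\<Sum>v\<in>B. real (card (nbrs H v)))"
      using \<open>B \<noteq> {}\<close> fin by (intro sum_strict_mono) (auto simp: B_def A_def)
    moreover have "(\<Sum>v\<in>verts H. real (card (nbrs H v))) =
        (\<Sum>v\<in>A. real (card (nbrs H v))) + (\<Sum>v\<in>B. real (card (nbrs H v)))"
      using sum.union_disjoint[OF fin AB(3)] AB(4) by simp
    \<comment> \<open>Rearranged, \<open>(l - \<delta>) * card B < (\<delta> - s) * card A\<close>.
      Since \<open>\<delta> \<ge> s\<close>, the right side is at most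
      \<open>(\<delta> - s) * c * card B\<close>, which equals the left side.\<close>
    ultimately have "real s * real (card A) + l * real (card B) < ?\<delta> * (real (card A) + real (card B))"
      using sum cardV by (simp add: mult.commute)
    moreover have "(?\<delta> - real s) * real (card A) \<le> (?\<delta> - real s) * (c * real (card B))"
      using A_le \<delta> by (intro mult_left_mono) auto
    ultimately show False unfolding l by (simp add: algebra_simps)
  qed
qed

theorem theorem4:
  fixes G :: "'a ugraph" and s t :: nat
  assumes "s \<ge> 1" and "t \<ge> 1"
    and "simple_graph G"
    and "\<not> contains_copy G (K_star s t)"
  shows "choosable G s (defect_bound s t G)"
proof -
  let ?d = "defect_bound s t G"
  have "choosable G (Suc (s - 1)) ?d"
  proof (rule choosable_if_low_degree_or_light_edge[OF assms(3)])
    fix H assume H: "subgraph H G" "verts H \<noteq> {}"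
    \<comment> \<open>With \<open>k = s - 1\<close> the light-edge threshold \<open>?d + k\<close>
      is the floor of \<open>N1\<close>, or more where \<open>nat\<close> truncates a negative value
      to 0.\<close>
    have le: "n \<le> ?d + (s - 1)" if "real n \<le> N1 s t (mad G) (2 * nabla_half G)" for n
    proof -
      have "int n \<le> \<lfloor>N1 s t (mad G) (2 * nabla_half G)\<rfloor>" using that by (simp add: le_floor_iff)
      with \<open>s \<ge> 1\<close> show ?thesis unfolding defect_bound_def by linarith
    qed
    show "(\<exists>v\<in>verts H. card (nbrs H v) \<le> s - 1) \<or>
      (\<exists>x y. {x, y} \<in> edges H \<and> card (nbrs H x) \<le> ?d + (s - 1) \<and> card (nbrs H y) \<le> ?d + (s - 1))"
    proof (cases "\<exists>v\<in>verts H. card (nbrs H v) \<le> s - 1")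
      case False
      then have "s \<le> card (nbrs H v)" if "v \<in> verts H" for v using that by force
      from light_edge[OF assms(3,4,1,2) H this] le show ?thesis by blast
    qed simp
  qed
  with \<open>s \<ge> 1\<close> show ?thesis by simp
qed

end
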